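(* For $n\ge 1$ let $a_n = |S_n^2(132,321)|$. Then $a_1=1$ and $a_{n+1} = a_n + n(n+2)$ for all $n\ge 1$.
   Context: A $3$-permutation of size $n$ is an ordered pair $(\sigma,\sigma')$ of permutations of $[n]=\{1,\dots,n\}$. A (classical) permutation $\tau\in S_n$ contains a pattern $\pi\in S_k$ if there are indices $c_1<\dots<c_k$ such that $\tau(c_1)\cdots\tau(c_k)$ is order-isomorphic to $\pi$, and avoids $\pi$ otherwise. A $3$-permutation $(\sigma,\sigma')$ avoids a pattern $\pi\in S_k$ if each of the three permutations $\sigma$, $\sigma'$, and $\sigma'\circ\sigma^{-1}$ (where $(\sigma'\circ\sigma^{-1})(i)=\sigma'(\sigma^{-1}(i))$) avoids $\pi$. $S_n^2(\pi_1,\dots,\pi_m)$ denotes the set of $3$-permutations of size $n$ avoiding each of $\pi_1,\dots,\pi_m$. Patterns are written in one-line notation. *)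

theory Defs
  imports "HOL-Combinatorics.Permutations"
begin

text \<open>A permutation of \<open>[n]\<close> is a function that permutes \<open>{1..n}\<close> (and so is the identity
  elsewhere). A pattern \<open>\<pi> \<in> S\<^sub>k\<close> is the list of its values in one-line notation; its
  positions are therefore counted from 0, while those of \<open>\<tau>\<close> are counted from 1.\<close>

definition contains_pattern :: "nat \<Rightarrow> (nat \<Rightarrow> nat) \<Rightarrow> nat list \<Rightarrow> bool" where
  "contains_pattern n \<tau> \<pi> \<longleftrightarrow>
     (\<exists>c :: nat \<Rightarrow> nat.
        strict_mono_on {..<length \<pi>} c \<and> c ` {..<length \<pi>} \<subseteq> {1..n} \<and>
        (\<forall>i<length \<pi>. \<forall>j<length \<pi>. \<tau> (c i) < \<tau> (c j) \<longleftrightarrow> \<pi> ! i < \<pi> ! j))"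

definition avoids_pattern :: "nat \<Rightarrow> (nat \<Rightarrow> nat) \<Rightarrow> nat list \<Rightarrow> bool" where
  "avoids_pattern n \<tau> \<pi> \<longleftrightarrow> \<not> contains_pattern n \<tau> \<pi>"

definition three_perms :: "nat \<Rightarrow> ((nat \<Rightarrow> nat) \<times> (nat \<Rightarrow> nat)) set" where
  "three_perms n = {(\<sigma>, \<sigma>'). \<sigma> permutes {1..n} \<and> \<sigma>' permutes {1..n}}"

definition three_perm_avoids ::
  "nat \<Rightarrow> (nat \<Rightarrow> nat) \<times> (nat \<Rightarrow> nat) \<Rightarrow> nat list \<Rightarrow> bool" where
  "three_perm_avoids n p \<pi> \<longleftrightarrow>
     (case p of (\<sigma>, \<sigma>') \<Rightarrow>
        avoids_pattern n \<sigma> \<pi> \<and> avoids_pattern n \<sigma>' \<pi> \<and> avoids_pattern n (\<sigma>' \<circ> inv \<sigma>) \<pi>)"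

definition avoiding_three_perms ::
  "nat \<Rightarrow> nat list set \<Rightarrow> ((nat \<Rightarrow> nat) \<times> (nat \<Rightarrow> nat)) set" where
  "avoiding_three_perms n P = {p \<in> three_perms n. \<forall>\<pi>\<in>P. three_perm_avoids n p \<pi>}"

end

theory Submission
  imports Defs
begin

text \<open>A permutation avoiding 132 and 321 that moves its maximal entry \<open>N\<close> has only smaller
  entries to the right of \<open>N\<close> than to its left, and both parts are increasing, so it is a rotation
  of \<open>[N]\<close>. Hence the avoiders of size \<open>N = n + 1\<close> are those of size \<open>n\<close> together with the
  rotations of \<open>[N]\<close>, and the latter act regularly on \<open>[N]\<close>. If one of \<open>\<sigma>\<close>, \<open>\<sigma>'\<close> moves \<open>N\<close>,
  regularity forces both to be rotations of \<open>[N]\<close>; and all pairs of rotations are admissible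
  because rotations form a group. The only pair counted twice is \<open>(id, id)\<close>, so \<open>a\<^sub>N - a\<^sub>n = N\<^sup>2 - 1\<close>.\<close>

section \<open>The two patterns as conditions on triples of positions\<close>

text \<open>Two strict inequalities suffice, since by transitivity they settle all nine comparisons
  between entries that the definition of containment demands.\<close>

lemma avoids_132_iff:
  "avoids_pattern n \<tau> [1, 3, 2] \<longleftrightarrow>
     (\<forall>i j k. 1 \<le> i \<and> i < j \<and> j < k \<and> k \<le> n \<longrightarrow> \<not> (\<tau> i < \<tau> k \<and> \<tau> k < \<tau> j))"
proof -
  have "contains_pattern n \<tau> [1, 3, 2] \<longleftrightarrow>
     (\<exists>i j k. 1 \<le> i \<and> i < j \<and> j < k \<and> k \<le> n \<and> \<tau> i < \<tau> k \<and> \<tau> k < \<tau> j)" (is "?L = ?R")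
  proof
    assume ?L
    then obtain c where c: "strict_mono_on {..<3} c" "c ` {..<3} \<subseteq> {1..n}"
      and o: "\<forall>i<3. \<forall>j<3. \<tau> (c i) < \<tau> (c j) \<longleftrightarrow> [1, 3, 2] ! i < ([1, 3, 2] ! j :: nat)"
      unfolding contains_pattern_def by (auto simp: eval_nat_numeral)
    have "c 0 < c 1" "c 1 < c 2" using c(1) by (auto simp: strict_mono_on_def)
    moreover have "1 \<le> c 0" "c 2 \<le> n"
      using subsetD[OF c(2) imageI, of 0] subsetD[OF c(2) imageI, of 2] by auto
    moreover have "\<tau> (c 0) < \<tau> (c 2)" "\<tau> (c 2) < \<tau> (c 1)"
      using o[rule_format, of 0 2] o[rule_format, of 2 1] by auto
    ultimately show ?R by blast
  next
    assume ?R
    then obtain i j k where *: "1 \<le> i" "i < j" "j < k" "k \<le> n" "\<tau> i < \<tau> k" "\<tau> k < \<tau> j" by blast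
    show ?L
      unfolding contains_pattern_def
      by (rule exI[of _ "\<lambda>x. [i, j, k] ! x"])
        (use * in \<open>auto simp: strict_mono_on_def less_Suc_eq nth_Cons split: nat.splits\<close>)
  qed
  then show ?thesis unfolding avoids_pattern_def by blast
qed

lemma avoids_321_iff:
  "avoids_pattern n \<tau> [3, 2, 1] \<longleftrightarrow>
     (\<forall>i j k. 1 \<le> i \<and> i < j \<and> j < k \<and> k \<le> n \<longrightarrow> \<not> (\<tau> k < \<tau> j \<and> \<tau> j < \<tau> i))"
proof -
  have "contains_pattern n \<tau> [3, 2, 1] \<longleftrightarrow>
     (\<exists>i j k. 1 \<le> i \<and> i < j \<and> j < k \<and> k \<le> n \<and> \<tau> k < \<tau> j \<and> \<tau> j < \<tau> i)" (is "?L = ?R")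
  proof
    assume ?L
    then obtain c where c: "strict_mono_on {..<3} c" "c ` {..<3} \<subseteq> {1..n}"
      and o: "\<forall>i<3. \<forall>j<3. \<tau> (c i) < \<tau> (c j) \<longleftrightarrow> [3, 2, 1] ! i < ([3, 2, 1] ! j :: nat)"
      unfolding contains_pattern_def by (auto simp: eval_nat_numeral)
    have "c 0 < c 1" "c 1 < c 2" using c(1) by (auto simp: strict_mono_on_def)
    moreover have "1 \<le> c 0" "c 2 \<le> n"
      using subsetD[OF c(2) imageI, of 0] subsetD[OF c(2) imageI, of 2] by auto
    moreover have "\<tau> (c 2) < \<tau> (c 1)" "\<tau> (c 1) < \<tau> (c 0)"
      using o[rule_format, of 2 1] o[rule_format, of 1 0] by auto
    ultimately show ?R by blast
  next
    assume ?R
    then obtain i j k where *: "1 \<le> i" "i < j" "j < k" "k \<le> n" "\<tau> k < \<tau> j" "\<tau> j < \<tau> i" by blast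
    show ?L
      unfolding contains_pattern_def
      by (rule exI[of _ "\<lambda>x. [i, j, k] ! x"])
        (use * in \<open>auto simp: strict_mono_on_def less_Suc_eq nth_Cons split: nat.splits\<close>)
  qed
  then show ?thesis unfolding avoids_pattern_def by blast
qed

section \<open>Exchanging two adjacent blocks\<close>

text \<open>The blocks \<open>{1..p}\<close> and \<open>{p+1..p+q}\<close> trade places, each
  keeping its inner order. On \<open>[p + q]\<close> this is addition of \<open>q\<close> modulo
  \<open>p + q\<close>. The first clause keeps 0 fixed, as a permutation of \<open>{1..n}\<close>
  must.\<close>

definition block_swap :: "nat \<Rightarrow> nat \<Rightarrow> nat \<Rightarrow> nat" where
  "block_swap p q i =
     (if i = 0 then 0 else if i \<le> p then i + q else if i \<le> p + q then i - p else i)"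

lemma block_swap_0 [simp]: "block_swap 0 q = id" "block_swap p 0 = id"
  by (auto simp: block_swap_def fun_eq_iff)

text \<open>After the exchange the blocks have lengths \<open>q\<close> and \<open>p\<close> in this
  order, so a second exchange with these lengths restores them. This yields both the inverse and
  bijectivity.\<close>

lemma block_swap_comp_swapped: "block_swap q p \<circ> block_swap p q = id"
  by (auto simp: block_swap_def fun_eq_iff)

lemma inv_block_swap: "inv (block_swap p q) = block_swap q p"
  by (rule inv_unique_comp) (rule block_swap_comp_swapped)+

lemma bij_block_swap: "bij (block_swap p q)"
  by (rule o_bij) (rule block_swap_comp_swapped)+

lemma block_swap_permutes: "p + q \<le> n \<Longrightarrow> block_swap p q permutes {1..n}"
  using bij_block_swap[of p q] unfolding permutes_def bij_iff
  by (auto simp: block_swap_def)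

section \<open>Classification of the avoiders of both patterns\<close>

definition avoiders :: "nat \<Rightarrow> (nat \<Rightarrow> nat) set" where
  "avoiders n = {\<sigma>. \<sigma> permutes {1..n} \<and> avoids_pattern n \<sigma> [1, 3, 2] \<and> avoids_pattern n \<sigma> [3, 2, 1]}"

text \<open>The values up to \<open>\<sigma> i\<close> are exactly
  \<open>1, ..., \<sigma> i\<close>, each attained once. This turns knowledge of the relative order
  of the entries into their actual values.\<close>

lemma permutes_eq_card_le:
  assumes "\<sigma> permutes {1..n}" "i \<in> {1..n::nat}"
  shows "\<sigma> i = card {j \<in> {1..n}. \<sigma> j \<le> \<sigma> i}"
proof -
  have im: "\<sigma> ` {1..n} = {1..n}" using assms(1) by (rule permutes_image)
  have "\<sigma> i \<in> {1..n}" using assms im by blast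
  have "\<sigma> ` {j \<in> {1..n}. \<sigma> j \<le> \<sigma> i} = {x \<in> \<sigma> ` {1..n}. x \<le> \<sigma> i}" by blast
  also have "\<dots> = {1..\<sigma> i}" unfolding im using \<open>\<sigma> i \<in> {1..n}\<close> by auto
  finally have "card (\<sigma> ` {j \<in> {1..n}. \<sigma> j \<le> \<sigma> i}) = \<sigma> i" by simp
  moreover have "inj_on \<sigma> {j \<in> {1..n}. \<sigma> j \<le> \<sigma> i}"
    using assms(1) by (auto intro: inj_on_subset[OF permutes_inj])
  ultimately show ?thesis by (simp add: card_image)
qed

text \<open>With the maximum at position \<open>p < N\<close>, the two patterns force the order of
  every pair of entries; counting ranks then gives the values.\<close>

lemma moving_max_imp_block_swap:
  assumes "\<sigma> \<in> avoiders N" "N \<ge> 1" "\<sigma> N \<noteq> N"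
  shows "\<exists>p q. p + q = N \<and> \<sigma> = block_swap p q"
proof -
  have perm: "\<sigma> permutes {1..N}"
    and a132: "\<And>i j k. 1 \<le> i \<Longrightarrow> i < j \<Longrightarrow> j < k \<Longrightarrow> k \<le> N \<Longrightarrow> \<sigma> i < \<sigma> k \<Longrightarrow> \<not> \<sigma> k < \<sigma> j"
    and a321: "\<And>i j k. 1 \<le> i \<Longrightarrow> i < j \<Longrightarrow> j < k \<Longrightarrow> k \<le> N \<Longrightarrow> \<sigma> k < \<sigma> j \<Longrightarrow> \<not> \<sigma> j < \<sigma> i"
    using assms(1) unfolding avoiders_def avoids_132_iff avoids_321_iff by blast+
  have "N \<in> \<sigma> ` {1..N}" using permutes_image[OF perm] assms(2) by simp
  then obtain p where p: "p \<in> {1..N}" "\<sigma> p = N" by auto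
  then have "p < N" using assms(3) by (metis atLeastAtMost_iff le_neq_implies_less)
  have le: "\<sigma> i \<le> N" if "i \<in> {1..N}" for i
    using permutes_in_image[OF perm, of i] that by auto
  have inj: "\<sigma> i = \<sigma> j \<longleftrightarrow> i = j" for i j
    using permutes_inj[OF perm] by (auto dest: injD)
  have lt: "\<sigma> i < N" if "i \<in> {1..N}" "i \<noteq> p" for i
    using le[OF that(1)] inj[of i p] that p by auto
  \<comment> \<open>For \<open>i < p\<close>, having \<open>\<sigma> i < \<sigma> j\<close> would
    make \<open>i, p, j\<close> an occurrence of 132 with the maximum as its 3.\<close>
  have desc: "\<sigma> j < \<sigma> i" if "1 \<le> i" "i \<le> p" "p < j" "j \<le> N" for i j
  proof (cases "i = p")
    case True
    then show ?thesis using lt[of j] that p by auto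
  next
    case False
    then have "\<not> \<sigma> i < \<sigma> j" using a132[of i p j] lt[of j] that p by auto
    then show ?thesis using inj[of i j] that by auto
  qed
  \<comment> \<open>A descent to the right of \<open>p\<close> would form 321 together with the
    maximum at \<open>p\<close>.\<close>
  have asc_right: "\<sigma> i < \<sigma> j" if "p < i" "i < j" "j \<le> N" for i j
  proof -
    have "\<not> \<sigma> j < \<sigma> i" using a321[of p i j] lt[of i] that p by auto
    then show ?thesis using inj[of i j] that by auto
  qed
  \<comment> \<open>By \<open>desc\<close>, the last entry \<open>\<sigma> N\<close> lies below the
    whole left block, so a descent in that block would extend to 321.\<close>
  have asc_left: "\<sigma> i < \<sigma> j" if "1 \<le> i" "i < j" "j \<le> p" for i j
  proof -
    have "\<not> \<sigma> j < \<sigma> i" using a321[of i j N] desc[of j N] \<open>p < N\<close> that by auto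
    then show ?thesis using inj[of i j] that by auto
  qed
  have left: "\<sigma> i = i + (N - p)" if i: "1 \<le> i" "i \<le> p" for i
  proof -
    have "{j \<in> {1..N}. \<sigma> j \<le> \<sigma> i} = {1..i} \<union> {p<..N}"
    proof (intro equalityI subsetI)
      fix j assume "j \<in> {j \<in> {1..N}. \<sigma> j \<le> \<sigma> i}"
      then show "j \<in> {1..i} \<union> {p<..N}" using asc_left[of i j] i by fastforce
    next
      fix j assume "j \<in> {1..i} \<union> {p<..N}"
      then show "j \<in> {j \<in> {1..N}. \<sigma> j \<le> \<sigma> i}"
        using asc_left[of j i] desc[of i j] i \<open>p < N\<close> by (cases "j = i") auto
    qed
    moreover have "card ({1..i} \<union> {p<..N}) = i + (N - p)"
      using i by (subst card_Un_disjoint) auto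
    ultimately show ?thesis using permutes_eq_card_le[OF perm, of i] i \<open>p < N\<close> by auto
  qed
  have right: "\<sigma> i = i - p" if i: "p < i" "i \<le> N" for i
  proof -
    have "{j \<in> {1..N}. \<sigma> j \<le> \<sigma> i} = {p<..i}"
    proof (intro equalityI subsetI)
      fix j assume "j \<in> {j \<in> {1..N}. \<sigma> j \<le> \<sigma> i}"
      then show "j \<in> {p<..i}" using asc_right[of i j] desc[of j i] i by fastforce
    next
      fix j assume "j \<in> {p<..i}"
      then show "j \<in> {j \<in> {1..N}. \<sigma> j \<le> \<sigma> i}"
        using asc_right[of j i] i by (cases "j = i") auto
    qed
    then show ?thesis using permutes_eq_card_le[OF perm, of i] i by auto
  qed
  have "\<sigma> i = block_swap p (N - p) i" for i
    using left[of i] right[of i] permutes_not_in[OF perm, of i] \<open>p < N\<close>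
    by (auto simp: block_swap_def)
  then show ?thesis using \<open>p < N\<close> by (intro exI[of _ p] exI[of _ "N - p"]) auto
qed

lemma avoiders_fixing_max:
  assumes "\<sigma> \<in> avoiders (Suc n)" "\<sigma> (Suc n) = Suc n"
  shows "\<sigma> \<in> avoiders n"
proof -
  have "\<sigma> permutes {1..n}"
    using assms permutes_superset[of \<sigma> "{1..Suc n}" "{1..n}"]
    by (force simp: avoiders_def le_Suc_eq)
  then show ?thesis
    using assms unfolding avoiders_def avoids_132_iff avoids_321_iff by (auto dest: le_SucI)
qed

text \<open>Only pairs taken from the two different blocks change their order, so the inversions
  form a product of two intervals; this shape excludes both patterns.\<close>

lemma block_swap_inversion_iff:
  "1 \<le> i \<Longrightarrow> i < j \<Longrightarrow>
     block_swap p q j < block_swap p q i \<longleftrightarrow> i \<le> p \<and> p < j \<and> j \<le> p + q"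
  by (auto simp: block_swap_def)

text \<open>In both patterns the last two positions \<open>j < k\<close> form an inversion, so
  \<open>j\<close> lies in the first block and \<open>k\<close> in the second. Then every
  \<open>i < j\<close> is inverted with \<open>k\<close>, against 132, and not with
  \<open>j\<close>, against 321.\<close>

lemma block_swap_in_avoiders:
  assumes "p + q \<le> n"
  shows "block_swap p q \<in> avoiders n"
proof -
  let ?b = "block_swap p q"
  have "\<not> (?b i < ?b k \<and> ?b k < ?b j) \<and> \<not> (?b k < ?b j \<and> ?b j < ?b i)"
    if "1 \<le> i" "i < j" "j < k" for i j k
  proof -
    have "1 \<le> j" "i < k" using that by auto
    then have "?b k < ?b j \<Longrightarrow> ?b k < ?b i" "?b k < ?b j \<Longrightarrow> \<not> ?b j < ?b i"
      using that by (auto simp only: block_swap_inversion_iff)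
    then show ?thesis by (metis not_less_iff_gr_or_eq)
  qed
  then show ?thesis
    using block_swap_permutes[OF assms] unfolding avoiders_def avoids_132_iff avoids_321_iff by blast
qed

text \<open>Induction on \<open>n\<close>: if the maximum is fixed, the permutation already avoids
  at the smaller size; if it is moved, the two blocks fill all of \<open>[n]\<close>.\<close>

lemma avoiders_eq_block_swaps: "avoiders n = {block_swap p q | p q. p + q \<le> n}"
proof (intro equalityI subsetI)
  fix \<sigma> assume "\<sigma> \<in> avoiders n"
  then show "\<sigma> \<in> {block_swap p q | p q. p + q \<le> n}"
  proof (induction n)
    case 0
    then have "\<sigma> = block_swap 0 0" by (auto simp: avoiders_def)
    then show ?case by blast
  next
    case (Suc n)
    show ?case
    proof (cases "\<sigma> (Suc n) = Suc n")
      case True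
      then have "\<sigma> \<in> {block_swap p q | p q. p + q \<le> n}"
        using Suc avoiders_fixing_max by blast
      then show ?thesis by fastforce
    next
      case False
      then obtain p q where "p + q = Suc n" "\<sigma> = block_swap p q"
        using moving_max_imp_block_swap[OF Suc.prems] by auto
      then show ?thesis by (metis (mono_tags, lifting) mem_Collect_eq order_refl)
    qed
  qed
qed (auto intro: block_swap_in_avoiders)

section \<open>The cyclic group of rotations and its regular action\<close>

definition rotations :: "nat \<Rightarrow> (nat \<Rightarrow> nat) set" where
  "rotations N = {block_swap p q | p q. p + q = N}"

lemma block_swap_in_rotations: "p + q = N \<Longrightarrow> block_swap p q \<in> rotations N"
  unfolding rotations_def by blast

lemma rotations_subset_avoiders: "rotations N \<subseteq> avoiders N"
  by (auto simp: rotations_def intro: block_swap_in_avoiders)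

lemma rotations_moving_max: "\<sigma> \<in> avoiders N \<Longrightarrow> N \<ge> 1 \<Longrightarrow> \<sigma> N \<noteq> N \<Longrightarrow> \<sigma> \<in> rotations N"
  using moving_max_imp_block_swap block_swap_in_rotations by blast

lemma id_in_rotations: "id \<in> rotations N"
  using block_swap_in_rotations[of 0 N] by simp

lemma inv_in_rotations: "f \<in> rotations N \<Longrightarrow> inv f \<in> rotations N"
  unfolding rotations_def using inv_block_swap add.commute by fastforce

text \<open>Shifts by \<open>v\<close> and \<open>q\<close> compose to the shift by
  \<open>v + q\<close> modulo \<open>N\<close>; the case split is the reduction modulo
  \<open>N\<close>.\<close>

lemma rotations_comp:
  assumes "f \<in> rotations N" "g \<in> rotations N"
  shows "f \<circ> g \<in> rotations N"
proof -
  obtain u v p q where f: "f = block_swap u v" "u + v = N" and g: "g = block_swap p q" "p + q = N"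
    using assms by (auto simp: rotations_def)
  show ?thesis
  proof (cases "v + q \<le> N")
    case True
    have "f \<circ> g = block_swap (N - (v + q)) (v + q)"
      unfolding f g using f(2) g(2) True by (auto simp: block_swap_def fun_eq_iff)
    then show ?thesis using True by (simp add: block_swap_in_rotations)
  next
    case False
    \<comment> \<open>The first block has length \<open>N - (v + q - N)\<close>, which equals
      \<open>u + p\<close> because \<open>u + v = p + q = N\<close>.\<close>
    have "f \<circ> g = block_swap (u + p) (v + q - N)"
      unfolding f g using f(2) g(2) False by (auto simp: block_swap_def fun_eq_iff)
    moreover have "(u + p) + (v + q - N) = N" using f(2) g(2) False by simp
    ultimately show ?thesis by (simp only: block_swap_in_rotations)
  qed
qed

text \<open>The image of a single point determines the shift modulo \<open>N\<close>.\<close>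

lemma rotations_eqI:
  assumes "f \<in> rotations N" "g \<in> rotations N" "x \<in> {1..N}" "f x = g x"
  shows "f = g"
proof -
  obtain u v p q where f: "f = block_swap u v" "u + v = N" and g: "g = block_swap p q" "p + q = N"
    using assms by (auto simp: rotations_def)
  \<comment> \<open>The shifts \<open>v\<close> and \<open>q\<close> lie between 0 and
    \<open>N\<close> and agree modulo \<open>N\<close>. They are equal, or one is 0 and the other
    \<open>N\<close>, in which case both rotations are the identity.\<close>
  have "(u = p \<and> v = q) \<or> (u = 0 \<and> q = 0) \<or> (v = 0 \<and> p = 0)"
    using assms(3,4) f(2) g(2) unfolding f(1) g(1) by (auto simp: block_swap_def split: if_splits)
  then show ?thesis unfolding f g by auto
qed

text \<open>The shifts below \<open>N\<close> list every rotation once: the shift by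
  \<open>N\<close> is again the identity, and the image of 1 recovers the shift.\<close>

lemma card_rotations:
  assumes "N \<ge> 1"
  shows "card (rotations N) = N"
proof -
  have "rotations N = (\<lambda>q. block_swap (N - q) q) ` {..<N}"
  proof (intro equalityI subsetI)
    fix f assume "f \<in> rotations N"
    then obtain p q where "f = block_swap p q" "p + q = N" by (auto simp: rotations_def)
    then show "f \<in> (\<lambda>q. block_swap (N - q) q) ` {..<N}"
      using assms by (cases "p = 0") (auto intro: image_eqI[of _ _ 0] image_eqI[of _ _ q])
  qed (auto intro: block_swap_in_rotations)
  moreover have "inj_on (\<lambda>q. block_swap (N - q) q) {..<N}"
  proof (rule inj_onI)
    have image_of_1: "block_swap (N - q) q 1 = Suc q" if "q < N" for q
      using that by (auto simp: block_swap_def)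
    fix q q' assume "q \<in> {..<N}" "q' \<in> {..<N}" "block_swap (N - q) q = block_swap (N - q') q'"
    then show "q = q'" using image_of_1[of q] image_of_1[of q'] by simp
  qed
  ultimately show ?thesis by (simp add: card_image)
qed

section \<open>The recursion for admissible pairs\<close>

lemma avoiding_three_perms_eq:
  "avoiding_three_perms n {[1, 3, 2], [3, 2, 1]} =
     {(\<sigma>, \<sigma>'). \<sigma> \<in> avoiders n \<and> \<sigma>' \<in> avoiders n \<and> \<sigma>' \<circ> inv \<sigma> \<in> avoiders n}"
proof -
  have "\<sigma>' \<circ> inv \<sigma> permutes {1..n}" if "\<sigma> permutes {1..n}" "\<sigma>' permutes {1..n}" for \<sigma> \<sigma>'
    using that by (intro permutes_compose permutes_inv)
  then show ?thesis
    unfolding avoiding_three_perms_def three_perms_def three_perm_avoids_def avoiders_def by auto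
qed

lemma avoiders_mono: "avoiders n \<subseteq> avoiders (Suc n)"
  unfolding avoiders_eq_block_swaps using le_SucI by blast

lemma avoiders_fix_Suc: "\<sigma> \<in> avoiders n \<Longrightarrow> \<sigma> (Suc n) = Suc n"
  by (auto simp: avoiders_def permutes_not_in)

text \<open>Whichever of the three permutations moves \<open>Suc n\<close> is a rotation. If only
  one of \<open>\<sigma>\<close>, \<open>\<sigma>'\<close> does so, the quotient
  \<open>\<sigma>' \<circ> inv \<sigma>\<close> moves \<open>Suc n\<close> too, and this second
  rotation determines the remaining component.\<close>

lemma avoiding_three_perms_Suc:
  "avoiding_three_perms (Suc n) {[1, 3, 2], [3, 2, 1]} =
     avoiding_three_perms n {[1, 3, 2], [3, 2, 1]} \<union> rotations (Suc n) \<times> rotations (Suc n)"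
    (is "?A (Suc n) = ?A n \<union> ?R \<times> ?R")
proof (intro equalityI subsetI)
  fix x assume "x \<in> ?A (Suc n)"
  then obtain \<sigma> \<sigma>' where x: "x = (\<sigma>, \<sigma>')" and s: "\<sigma> \<in> avoiders (Suc n)" "\<sigma>' \<in> avoiders (Suc n)"
    and t: "\<sigma>' \<circ> inv \<sigma> \<in> avoiders (Suc n)" unfolding avoiding_three_perms_eq by blast
  let ?\<tau> = "\<sigma>' \<circ> inv \<sigma>"
  have perm: "\<sigma> permutes {1..Suc n}" using s(1) by (simp add: avoiders_def)
  have inv: "inv \<sigma> (\<sigma> i) = i" for i by (simp add: permutes_inverses(2)[OF perm])
  note rot = rotations_moving_max[of _ "Suc n", simplified]
  consider "\<sigma> (Suc n) = Suc n" "\<sigma>' (Suc n) = Suc n"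
    | "\<sigma> (Suc n) \<noteq> Suc n" "\<sigma>' (Suc n) \<noteq> Suc n"
    | "\<sigma> (Suc n) \<noteq> Suc n" "\<sigma>' (Suc n) = Suc n"
    | "\<sigma> (Suc n) = Suc n" "\<sigma>' (Suc n) \<noteq> Suc n" by blast
  then show "x \<in> ?A n \<union> ?R \<times> ?R"
  proof cases
    case 1
    then have "?\<tau> (Suc n) = Suc n" using inv[of "Suc n"] by simp
    then show ?thesis
      using 1 x s t avoiders_fixing_max unfolding avoiding_three_perms_eq by blast
  next
    case 2
    then show ?thesis using x s rot by auto
  next
    case 3
    \<comment> \<open>The preimage of \<open>Suc n\<close> under \<open>?\<tau>\<close> is a
      different point, so \<open>?\<tau>\<close> moves \<open>Suc n\<close>; then
      \<open>\<sigma>'\<close> is the product of the rotations \<open>?\<tau>\<close> and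
      \<open>\<sigma>\<close>.\<close>
    have "?\<tau> (\<sigma> (Suc n)) = Suc n" using 3 inv by simp
    moreover have "inj ?\<tau>" using t by (auto simp: avoiders_def intro: permutes_inj)
    ultimately have "?\<tau> (Suc n) \<noteq> Suc n" using 3(1) by (metis injD)
    then have "?\<tau> \<in> ?R" using t rot by blast
    moreover have sR: "\<sigma> \<in> ?R" using s 3 rot by blast
    ultimately have "?\<tau> \<circ> \<sigma> \<in> ?R" by (rule rotations_comp)
    moreover have "?\<tau> \<circ> \<sigma> = \<sigma>'" using inv by (simp add: fun_eq_iff)
    ultimately show ?thesis using x sR by simp
  next
    case 4
    \<comment> \<open>Two rotations that agree at one point coincide, and cancelling
      \<open>\<sigma>'\<close> leaves \<open>\<sigma> = id\<close>, which is itself a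
      rotation.\<close>
    have eq: "?\<tau> (Suc n) = \<sigma>' (Suc n)" using 4 inv[of "Suc n"] by simp
    then have "?\<tau> \<in> ?R" using t rot 4 by metis
    moreover have sR: "\<sigma>' \<in> ?R" using s 4 rot by blast
    ultimately have "?\<tau> = \<sigma>'" using eq by (intro rotations_eqI[of _ "Suc n"]) auto
    then have "\<sigma>' i = \<sigma>' (\<sigma> i)" for i using inv by (metis comp_apply)
    moreover have "inj \<sigma>'" using s(2) by (auto simp: avoiders_def intro: permutes_inj)
    ultimately have "\<sigma> = id" by (metis injD eq_id_iff)
    then show ?thesis using x sR id_in_rotations by auto
  qed
next
  fix x assume "x \<in> ?A n \<union> ?R \<times> ?R"
  then show "x \<in> ?A (Suc n)"
    using avoiders_mono[of n] rotations_subset_avoiders[of "Suc n"]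
      rotations_comp[of _ "Suc n"] inv_in_rotations[of _ "Suc n"]
    unfolding avoiding_three_perms_eq by blast
qed

section \<open>Counting by inclusion and exclusion\<close>

lemma finite_avoiding_three_perms: "finite (avoiding_three_perms n P)"
proof (rule finite_subset)
  show "avoiding_three_perms n P \<subseteq> {\<sigma>. \<sigma> permutes {1..n}} \<times> {\<sigma>. \<sigma> permutes {1..n}}"
    by (auto simp: avoiding_three_perms_def three_perms_def)
qed (simp add: finite_permutations)

lemma id_in_avoiders: "id \<in> avoiders n"
  using block_swap_in_avoiders[of 0 0 n] by simp

text \<open>Avoiders of size \<open>n\<close> fix \<open>Suc n\<close>, and by regularity the
  identity is the only such rotation.\<close>

lemma avoiding_three_perms_Int_rotations:
  "avoiding_three_perms n {[1, 3, 2], [3, 2, 1]} \<inter> rotations (Suc n) \<times> rotations (Suc n) = {(id, id)}"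
proof -
  have "avoiders n \<inter> rotations (Suc n) = {id}"
    using rotations_eqI[of _ "Suc n" id "Suc n"] avoiders_fix_Suc id_in_rotations id_in_avoiders
    by auto
  then show ?thesis unfolding avoiding_three_perms_eq using id_in_avoiders by auto
qed

text \<open>The union gains \<open>(n + 1)^2\<close> pairs of rotations, of which one was already
  present, and \<open>(n + 1)^2 - 1 = n * (n + 2)\<close>.\<close>

lemma card_avoiding_three_perms_Suc:
  "card (avoiding_three_perms (Suc n) {[1, 3, 2], [3, 2, 1]}) =
     card (avoiding_three_perms n {[1, 3, 2], [3, 2, 1]}) + n * (n + 2)" (is "card (?A (Suc n)) = _")
proof -
  let ?R = "rotations (Suc n)"
  have card: "card ?R = Suc n" by (simp add: card_rotations)
  then have "finite ?R" by (metis card.infinite nat.distinct(1))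
  then have "card (?A n) + card (?R \<times> ?R) = card (?A (Suc n)) + card (?A n \<inter> ?R \<times> ?R)"
    unfolding avoiding_three_perms_Suc by (intro card_Un_Int finite_avoiding_three_perms) simp
  then show ?thesis
    unfolding avoiding_three_perms_Int_rotations card_cartesian_product card by simp
qed

theorem theorem3p2:
  fixes a :: "nat \<Rightarrow> nat"
  assumes a_def: "\<And>n. n \<ge> 1 \<Longrightarrow> a n = card (avoiding_three_perms n {[1, 3, 2], [3, 2, 1]})"
  shows "a 1 = 1 \<and> (\<forall>n\<ge>1. a (n + 1) = a n + n * (n + 2))"
proof
  \<comment> \<open>The recursion also holds at \<open>n = 0\<close>, where its increment is 0, so
    \<open>a 1\<close> equals the count for size 0, namely the single pair of identities.\<close>
  have "avoiders 0 = {id}"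
    unfolding avoiders_eq_block_swaps by auto
  then have "x \<in> avoiding_three_perms 0 {[1, 3, 2], [3, 2, 1]} \<longleftrightarrow> x = (id, id)" for x
    by (cases x) (simp only: avoiding_three_perms_eq mem_Collect_eq case_prod_conv singleton_iff
        prod.inject, metis comp_id inv_id)
  then have "avoiding_three_perms 0 {[1, 3, 2], [3, 2, 1]} = {(id, id)}"
    by blast
  then show "a 1 = 1" using card_avoiding_three_perms_Suc[of 0] by (simp add: a_def)
  show "\<forall>n\<ge>1. a (n + 1) = a n + n * (n + 2)"
    using card_avoiding_three_perms_Suc by (simp add: a_def)
qed

end
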